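(* Let $p$ be a positive integer and let $\mu$ be a probability distribution on $\mathbb{R}^{n\times n}$ with bounded support such that there is a proper cone $K\subset\mathbb{R}^n$ with $MK\subset K$ for every $M\in\operatorname{supp}\mu$. Assume that $\Sigma_\mu$ is $p$th mean stable and let $\gamma\in(\rho_{p,\mu},1)$ be arbitrary. Then there exists a cone linear absolute norm $\|\cdot\|$ on $\mathbb{R}^{n^p}$ such that $V(x)=\|x^{\otimes p}\|$, $x\in\mathbb{R}^n$, is a stochastic Lyapunov function for $\Sigma_\mu$ with degree $p$ and growth rate $\gamma$.
   Context: A cone in $\mathbb{R}^m$ is a subset closed under multiplication by nonnegative numbers; it is proper if it is closed, convex, has nonempty interior, and is pointed ($x,-x\in K$ implies $x=0$). Its dual cone is $K^*=\{f\in\mathbb{R}^m: f^\top x\ge0\text{ for every }x\in K\}$. A norm $\|\cdot\|$ on $\mathbb{R}^m$ is cone linear absolute if there is a proper cone $K\subset\mathbb{R}^m$ with respect to which it is both cone absolute, i.e. $\|x\|=\inf\{\|v+w\|: v,w\in K,\ x=v-w\}$ for every $x\in\mathbb{R}^m$, and cone linear, i.e. there exists $f\in K^*$ with $\|x\|=f^\top x$ for every $x\in K$. $\Sigma_\mu$ is the stochastic switched linear system $x(k+1)=A_kx(k)$ where the $A_k$ are independent random matrices with distribution $\mu$ and $x(0)=x_0\in\mathbb{R}^n$ is constant. Writing $|\cdot|$ for the Euclidean norm on $\mathbb{R}^n$: $\Sigma_\mu$ is $p$th mean stable if there exist $C>0$ and $\gamma\in[0,1)$ such that $E[|x(k)|^p]\le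 C\gamma^{pk}|x_0|^p$ for every $k\ge 0$ and $x_0\in\mathbb{R}^n$. A function $V\colon\mathbb{R}^n\to\mathbb{R}$ is a stochastic Lyapunov function of degree $p$ for $\Sigma_\mu$ with growth rate $\gamma\in[0,1)$ if there exist positive numbers $C_1,C_2$ such that, for every $x\in\mathbb{R}^n$, $C_1|x|^p\le V(x)\le C_2|x|^p$ and $E[V(Ax)]\le\gamma^pV(x)$, where $A$ has distribution $\mu$. The $p$-radius of $\mu$ is $\rho_{p,\mu}=\lim_{k\to\infty}(E[\|A_k\cdots A_1\|^p])^{1/(pk)}$ with $A_1,A_2,\dots$ independent with distribution $\mu$, for any matrix norm (the limit exists and does not depend on the norm). $x^{\otimes p}$ is the $p$-fold Kronecker power of the column vector $x$. *)

theory Defs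
  imports "HOL-Probability.Probability"
begin

section \<open>Cones and norms\<close>

definition proper_cone :: "'a::euclidean_space set \<Rightarrow> bool" where
  "proper_cone K \<longleftrightarrow>
     cone K \<and> closed K \<and> convex K \<and> interior K \<noteq> {} \<and> (\<forall>x. x \<in> K \<and> - x \<in> K \<longrightarrow> x = 0)"

definition dual_cone :: "'a::euclidean_space set \<Rightarrow> 'a set" where
  "dual_cone K = {f. \<forall>x\<in>K. 0 \<le> f \<bullet> x}"

definition is_norm :: "('a::real_vector \<Rightarrow> real) \<Rightarrow> bool" where
  "is_norm N \<longleftrightarrow>
     (\<forall>x. 0 \<le> N x) \<and> (\<forall>x. N x = 0 \<longleftrightarrow> x = 0) \<and>
     (\<forall>c x. N (c *\<^sub>R x) = \<bar>c\<bar> * N x) \<and> (\<forall>x y. N (x + y) \<le> N x + N y)"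

definition cone_absolute :: "'a::euclidean_space set \<Rightarrow> ('a \<Rightarrow> real) \<Rightarrow> bool" where
  "cone_absolute K N \<longleftrightarrow> (\<forall>x. N x = Inf {N (v + w) | v w. v \<in> K \<and> w \<in> K \<and> x = v - w})"

definition cone_linear :: "'a::euclidean_space set \<Rightarrow> ('a \<Rightarrow> real) \<Rightarrow> bool" where
  "cone_linear K N \<longleftrightarrow> (\<exists>f\<in>dual_cone K. \<forall>x\<in>K. N x = f \<bullet> x)"

definition cone_linear_absolute_norm :: "('a::euclidean_space \<Rightarrow> real) \<Rightarrow> bool" where
  "cone_linear_absolute_norm N \<longleftrightarrow>
     is_norm N \<and> (\<exists>K. proper_cone K \<and> cone_absolute K N \<and> cone_linear K N)"


section \<open>Stochastic switched linear systems\<close>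

definition supp :: "'a::topological_space measure \<Rightarrow> 'a set" where
  "supp \<mu> = {x. \<forall>U. open U \<and> x \<in> U \<longrightarrow> emeasure \<mu> U > 0}"

text \<open>
  The matrices of the system are the coordinates \<open>\<omega> 0, \<omega> 1, \<dots>\<close> of a random sequence \<open>\<omega>\<close>
  distributed according to the countable product of \<open>\<mu>\<close>. All quantities below depend only on the
  joint law of the matrices, so nothing is lost by this choice of independent random
  matrices; see \<open>switching_law_eq_distr\<close>.
\<close>

definition switching_law :: "(real^'n^'n) measure \<Rightarrow> (nat \<Rightarrow> real^'n^'n) measure" where
  "switching_law \<mu> = (\<Pi>\<^sub>M k\<in>UNIV. \<mu>)"

lemma (in prob_space) switching_law_eq_distr:
  fixes A :: "nat \<Rightarrow> 'a \<Rightarrow> real^'n^'n"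
  assumes indep: "indep_vars (\<lambda>_. borel) A UNIV"
    and law: "\<And>k. distr M borel (A k) = \<mu>"
  shows "switching_law \<mu> = distr M (\<Pi>\<^sub>M k\<in>UNIV. borel) (\<lambda>\<omega> k. A k \<omega>)"
proof -
  have "random_variable borel (A k)" for k
    using indep by (auto simp: indep_vars_def)
  from indep_vars_iff_distr_eq_PiM[where X = A and M' = "\<lambda>_. borel" and I = UNIV, OF _ this] indep law
  show ?thesis by (simp add: switching_law_def restrict_UNIV)
qed

primrec trajectory :: "(nat \<Rightarrow> real^'n^'n) \<Rightarrow> real^'n \<Rightarrow> nat \<Rightarrow> real^'n" where
  "trajectory \<omega> x0 0 = x0"
| "trajectory \<omega> x0 (Suc k) = \<omega> k *v trajectory \<omega> x0 k"

text \<open>\<open>matrix_product \<omega> k\<close> is \<open>\<omega> k ** \<dots> ** \<omega> 1\<close>, leaving \<open>\<omega> 0\<close> unused.\<close>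

primrec matrix_product :: "(nat \<Rightarrow> real^'n^'n) \<Rightarrow> nat \<Rightarrow> real^'n^'n" where
  "matrix_product \<omega> 0 = mat 1"
| "matrix_product \<omega> (Suc k) = \<omega> (Suc k) ** matrix_product \<omega> k"

text \<open>
  Integrability is required explicitly wherever an inequality for an expectation is stated,
  since the Bochner integral of a non-integrable function is 0.
\<close>

definition mean_stable :: "nat \<Rightarrow> (real^'n^'n) measure \<Rightarrow> bool" where
  "mean_stable p \<mu> \<longleftrightarrow>
     (\<exists>C \<gamma>. C > 0 \<and> 0 \<le> \<gamma> \<and> \<gamma> < 1 \<and>
        (\<forall>k x0. integrable (switching_law \<mu>) (\<lambda>\<omega>. norm (trajectory \<omega> x0 k) ^ p) \<and>
           (\<integral>\<omega>. norm (trajectory \<omega> x0 k) ^ p \<partial>switching_law \<mu>)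
              \<le> C * \<gamma> ^ (p * k) * norm x0 ^ p))"

text \<open>
  The matrix norm used is the Frobenius norm, which is the library norm on \<^typ>\<open>real^'n^'n\<close>.
\<close>

definition p_radius :: "nat \<Rightarrow> (real^'n^'n) measure \<Rightarrow> real" where
  "p_radius p \<mu> =
     lim (\<lambda>k. (\<integral>\<omega>. norm (matrix_product \<omega> k) ^ p \<partial>switching_law \<mu>)
                powr (1 / (real p * real k)))"

definition stochastic_lyapunov ::
    "(real^'n^'n) measure \<Rightarrow> nat \<Rightarrow> real \<Rightarrow> (real^'n \<Rightarrow> real) \<Rightarrow> bool" where
  "stochastic_lyapunov \<mu> p \<gamma> V \<longleftrightarrow>
     0 \<le> \<gamma> \<and> \<gamma> < 1 \<and>
     (\<exists>C1 C2. C1 > 0 \<and> C2 > 0 \<and>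
        (\<forall>x. C1 * norm x ^ p \<le> V x \<and> V x \<le> C2 * norm x ^ p \<and>
           integrable \<mu> (\<lambda>A. V (A *v x)) \<and>
           (\<integral>A. V (A *v x) \<partial>\<mu>) \<le> \<gamma> ^ p * V x))"


section \<open>Kronecker powers\<close>

text \<open>
  The entries of the \<open>p\<close>-fold Kronecker power of \<open>x\<close> are the products
  \<open>x\<^sub>i\<^sub>1 \<cdots> x\<^sub>i\<^sub>p\<close>, one for each multi-index \<open>(i\<^sub>1, \<dots>, i\<^sub>p)\<close>. The map \<open>idx\<close> says which multi-index
  labels a given coordinate: \<open>multi_indexing p idx\<close> makes \<^typ>\<open>real^'m\<close> the space of
  dimension \<open>CARD('n) ^ p\<close>, with its coordinates listed in some order. The usual lexicographic
  order, with respect to any enumeration of \<^typ>\<open>'n\<close>, is one of the possible choices.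
\<close>

definition multi_indexing :: "nat \<Rightarrow> ('m::finite \<Rightarrow> nat \<Rightarrow> 'n::finite) \<Rightarrow> bool" where
  "multi_indexing p idx \<longleftrightarrow> bij_betw idx UNIV ({..<p} \<rightarrow>\<^sub>E UNIV)"

definition kron_power :: "('m::finite \<Rightarrow> nat \<Rightarrow> 'n::finite) \<Rightarrow> nat \<Rightarrow> real^'n \<Rightarrow> real^'m" where
  "kron_power idx p x = (\<chi> i. \<Prod>j<p. x $ idx i j)"

lemma multi_indexing_exists_iff:
  "(\<exists>idx :: 'm::finite \<Rightarrow> nat \<Rightarrow> 'n::finite. multi_indexing p idx) \<longleftrightarrow> CARD('m) = CARD('n) ^ p"
proof -
  have fin: "finite ({..<p} \<rightarrow>\<^sub>E (UNIV :: 'n set))"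
    by (intro finite_PiE) auto
  have card: "card ({..<p} \<rightarrow>\<^sub>E (UNIV :: 'n set)) = CARD('n) ^ p"
    by (simp add: card_PiE)
  show ?thesis
    unfolding multi_indexing_def card[symmetric]
    by (metis bij_betw_iff_card fin finite_class.finite_UNIV)
qed

end

theory Submission
  imports Defs
begin

text \<open>
  Let \<open>T\<close> be the cone of all tensors on which every tensor product of \<open>p\<close> elements of the dual cone
  of \<open>K\<close> is nonnegative. It is proper and invariant under the Kronecker powers of the matrices in
  the support, hence under the mean \<open>B\<close> of the \<open>p\<close>-fold Kronecker power of the random matrix. The powers
  \<open>B\<^sup>k\<close> are bounded by the \<open>p\<close>-th moments of the random products, which are submultiplicative; so
  \<open>B\<^sup>k\<close> decays faster than the \<open>k\<close>-th power of \<open>\<gamma>\<^sup>p\<close>, and a geometric series built from a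
  functional \<open>f\<close> that is strictly positive on \<open>T\<close> yields a functional \<open>F \<ge> f\<close> on \<open>T\<close> that \<open>B\<close>
  contracts by \<open>\<gamma>\<^sup>p\<close>. The norm sought is the infimum of \<open>F (v + w)\<close> over all decompositions
  \<open>x = v - w\<close> with \<open>v\<close> and \<open>w\<close> in \<open>T\<close>.
\<close>

section \<open>Cone linear absolute norms\<close>

text \<open>By pointedness, nonzero vectors of \<open>K\<close> cannot cancel, so
  \<open>K - {0}\<close> is convex and contains the convex hull of the unit vectors of
  \<open>K\<close>. That hull is compact and misses 0, so a hyperplane separates it from 0 with a
  margin \<open>b\<close>; homogeneity extends the bound to all of \<open>K\<close>.\<close>

lemma pointed_cone_separation:
  fixes K :: "'a::euclidean_space set"
  assumes "cone K" "closed K" "convex K" and pointed: "\<And>x. x \<in> K \<Longrightarrow> - x \<in> K \<Longrightarrow> x = 0"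
  obtains f b where "b > 0" "\<And>x. x \<in> K \<Longrightarrow> b * norm x \<le> f \<bullet> x"
proof -
  let ?B = "convex hull (K \<inter> sphere 0 1)"
  have add: "x + y \<in> K" if "x \<in> K" "y \<in> K" for x y
    using \<open>cone K\<close> \<open>convex K\<close> that convex_cone by blast
  have "convex (K - {0})"
    unfolding convex_alt
  proof (intro ballI allI impI)
    fix x y :: 'a and u :: real
    assume xy: "x \<in> K - {0}" "y \<in> K - {0}" and u: "0 \<le> u \<and> u \<le> 1"
    have ux: "(1 - u) *\<^sub>R x \<in> K" and uy: "u *\<^sub>R y \<in> K"
      using \<open>cone K\<close> xy u by (auto simp: cone_def)
    moreover have "(1 - u) *\<^sub>R x + u *\<^sub>R y \<noteq> 0"
    proof
      assume sum: "(1 - u) *\<^sub>R x + u *\<^sub>R y = 0"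
      then have "- (u *\<^sub>R y) \<in> K"
        using ux by (metis add_eq_0_iff2)
      then have "u *\<^sub>R y = 0"
        using uy pointed by blast
      then show False
        using sum xy by auto
    qed
    ultimately show "(1 - u) *\<^sub>R x + u *\<^sub>R y \<in> K - {0}"
      using add by blast
  qed
  moreover have "K \<inter> sphere 0 1 \<subseteq> K - {0}"
    by auto
  ultimately have "?B \<subseteq> K - {0}"
    by (rule hull_minimal[rotated])
  then have "0 \<notin> ?B"
    by blast
  moreover have "compact ?B"
    using \<open>closed K\<close> by (intro compact_convex_hull closed_Int_compact) auto
  ultimately obtain f b where f: "f \<noteq> 0" "0 < b" "\<forall>x\<in>?B. f \<bullet> x > b"
    using separating_hyperplane_closed_0[of ?B] compact_imp_closed by auto
  show thesis
  proof
    fix x assume "x \<in> K"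
    show "b * norm x \<le> f \<bullet> x"
    proof (cases "x = 0")
      case False
      have "(1 / norm x) *\<^sub>R x \<in> K \<inter> sphere 0 1"
        using \<open>cone K\<close> \<open>x \<in> K\<close> False by (auto simp: cone_def)
      then have "b < f \<bullet> ((1 / norm x) *\<^sub>R x)"
        by (intro bspec[OF f(3)] hull_inc)
      then show ?thesis
        using False by (simp add: field_simps)
    qed simp
  qed fact
qed

section \<open>The norm attached to a cone and a strictly positive functional\<close>

text \<open>
  With \<open>f\<close> in the interior of the dual cone this is the norm that is cone absolute with respect
  to \<open>K\<close> and equal to \<open>f\<close> on \<open>K\<close>.
\<close>

definition cone_norm :: "'a::euclidean_space set \<Rightarrow> 'a \<Rightarrow> 'a \<Rightarrow> real" where
  "cone_norm K f x = Inf {f \<bullet> (v + w) | v w. v \<in> K \<and> w \<in> K \<and> x = v - w}"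

text \<open>The lower bound is a quantitative form of \<open>f\<close> being interior to the dual
  cone; \<open>b\<close> becomes the constant in the comparison of the cone norm with the Euclidean
  norm from below.\<close>

locale strictly_positive_functional =
  fixes K :: "'a::euclidean_space set" and f :: 'a and b :: real
  assumes K: "proper_cone K" and b: "b > 0" and lower: "\<And>x. x \<in> K \<Longrightarrow> b * norm x \<le> f \<bullet> x"
begin

lemma zero_mem: "0 \<in> K"
  using K interior_subset unfolding proper_cone_def by (metis cone_contains_0 subset_empty)

lemma add_mem: "x \<in> K \<Longrightarrow> y \<in> K \<Longrightarrow> x + y \<in> K"
  using K convex_cone unfolding proper_cone_def by blast

lemma scale_mem: "x \<in> K \<Longrightarrow> 0 \<le> c \<Longrightarrow> c *\<^sub>R x \<in> K"
  using K unfolding proper_cone_def cone_def by blast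

lemma nonneg: "x \<in> K \<Longrightarrow> 0 \<le> f \<bullet> x"
  using lower[of x] b by (meson mult_nonneg_nonneg norm_ge_zero order.trans less_imp_le)

lemma norm_diff_le:
  assumes "v \<in> K" "w \<in> K"
  shows "b * norm (v - w) \<le> f \<bullet> (v + w)"
proof -
  have "b * norm (v - w) \<le> b * norm v + b * norm w"
    using b norm_triangle_ineq4[of v w] by (simp flip: distrib_left)
  also have "\<dots> \<le> f \<bullet> (v + w)"
    using lower assms by (simp add: inner_add_right add_mono)
  finally show ?thesis .
qed

text \<open>If the ball of radius \<open>r\<close> about \<open>e\<close> lies in \<open>K\<close>,
  then \<open>t *\<^sub>R e + x\<close> is in \<open>K\<close> for \<open>t = norm x / r\<close>,
  and \<open>x\<close> is its difference with \<open>t *\<^sub>R e\<close>.\<close>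

lemma decomposition:
  obtains C where "C > 0" "\<And>x. \<exists>v\<in>K. \<exists>w\<in>K. x = v - w \<and> f \<bullet> (v + w) \<le> C * norm x"
proof -
  obtain e where "e \<in> interior K"
    using K unfolding proper_cone_def by blast
  then obtain r where r: "r > 0" "cball e r \<subseteq> K"
    by (meson mem_interior_cball)
  \<comment> \<open>The first summand pays for the two copies of \<open>t *\<^sub>R e\<close>, the
    second for \<open>x\<close> itself by Cauchy-Schwarz; the 1 makes strict positivity
    immediate.\<close>
  let ?C = "2 / r * (f \<bullet> e) + norm f + 1"
  have e: "e \<in> K"
    using r by auto
  show thesis
  proof
    show "?C > 0"
      using nonneg[OF e] r by (simp add: add_nonneg_pos)
    fix x :: 'a
    let ?t = "norm x / r"
    have "e + (r / norm x) *\<^sub>R x \<in> cball e r" if "x \<noteq> 0"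
      using that r by (simp add: dist_norm)
    then have "?t *\<^sub>R (e + (r / norm x) *\<^sub>R x) \<in> K" if "x \<noteq> 0"
      using that r by (intro scale_mem) auto
    then have "?t *\<^sub>R e + x \<in> K"
      using r zero_mem by (cases "x = 0") (auto simp: scaleR_add_right)
    moreover have "?t *\<^sub>R e \<in> K"
      using e r by (intro scale_mem) auto
    moreover have "f \<bullet> x \<le> norm f * norm x"
      by (rule norm_cauchy_schwarz)
    then have "f \<bullet> ((?t *\<^sub>R e + x) + ?t *\<^sub>R e) \<le> ?C * norm x"
      by (simp add: inner_add_right algebra_simps add_increasing)
    ultimately show "\<exists>v\<in>K. \<exists>w\<in>K. x = v - w \<and> f \<bullet> (v + w) \<le> ?C * norm x"
      by (metis add_diff_cancel_left')
  qed
qed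

lemma decomp_nonempty: "{f \<bullet> (v + w) | v w. v \<in> K \<and> w \<in> K \<and> x = v - w} \<noteq> {}"
proof -
  obtain C where "\<And>x. \<exists>v\<in>K. \<exists>w\<in>K. x = v - w \<and> f \<bullet> (v + w) \<le> C * norm x"
    using decomposition by blast
  then show ?thesis
    by fast
qed

lemma cone_norm_le: "v \<in> K \<Longrightarrow> w \<in> K \<Longrightarrow> cone_norm K f (v - w) \<le> f \<bullet> (v + w)"
  unfolding cone_norm_def by (rule cInf_lower) (auto intro!: bdd_belowI[of _ 0] nonneg add_mem)

text \<open>The inequalities between cone norms below come from this rule: the larger side is the
  infimum, so it suffices to transform an arbitrary decomposition of its argument.\<close>

lemma cone_norm_geI:
  assumes "\<And>v w. v \<in> K \<Longrightarrow> w \<in> K \<Longrightarrow> x = v - w \<Longrightarrow> c \<le> f \<bullet> (v + w)"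
  shows "c \<le> cone_norm K f x"
  unfolding cone_norm_def using assms by (intro cInf_greatest decomp_nonempty) auto

lemma cone_norm_lower: "b * norm x \<le> cone_norm K f x"
  by (rule cone_norm_geI) (simp add: norm_diff_le)

lemma cone_norm_upper:
  obtains C where "C > 0" "\<And>x. cone_norm K f x \<le> C * norm x"
  using decomposition by (metis cone_norm_le order_trans)

text \<open>The decomposition \<open>x = x - 0\<close> is optimal, since any other one costs
  \<open>f \<bullet> (v + w) = f \<bullet> x + 2 * (f \<bullet> w)\<close>.\<close>

lemma cone_norm_eq:
  assumes "x \<in> K"
  shows "cone_norm K f x = f \<bullet> x"
proof (rule antisym)
  show "cone_norm K f x \<le> f \<bullet> x"
    using cone_norm_le[OF assms zero_mem] by simp
  show "f \<bullet> x \<le> cone_norm K f x"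
  proof (rule cone_norm_geI)
    fix v w assume "v \<in> K" "w \<in> K" "x = v - w"
    then show "f \<bullet> x \<le> f \<bullet> (v + w)"
      using nonneg[of w] by (simp add: inner_add_right inner_diff_right)
  qed
qed

lemma cone_norm_triangle: "cone_norm K f (x + y) \<le> cone_norm K f x + cone_norm K f y"
proof -
  \<comment> \<open>The two infima on the right are removed one after the other, each time with the
    other summand moved to the left; decompositions of \<open>x\<close> and \<open>y\<close> add up
    to one of \<open>x + y\<close>.\<close>
  have "cone_norm K f (x + y) - cone_norm K f y \<le> cone_norm K f x"
  proof (rule cone_norm_geI)
    fix v w assume vw: "v \<in> K" "w \<in> K" "x = v - w"
    have "cone_norm K f (x + y) - f \<bullet> (v + w) \<le> cone_norm K f y"
    proof (rule cone_norm_geI)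
      fix v' w' assume "v' \<in> K" "w' \<in> K" "y = v' - w'"
      then have "cone_norm K f ((v + v') - (w + w')) \<le> f \<bullet> ((v + v') + (w + w'))"
        using vw add_mem by (intro cone_norm_le) auto
      moreover have "(v + v') - (w + w') = x + y"
        using vw \<open>y = v' - w'\<close> by simp
      ultimately show "cone_norm K f (x + y) - f \<bullet> (v + w) \<le> f \<bullet> (v' + w')"
        by (simp add: inner_add_right)
    qed
    then show "cone_norm K f (x + y) - cone_norm K f y \<le> f \<bullet> (v + w)"
      by simp
  qed
  then show ?thesis
    by simp
qed

lemma cone_norm_minus: "cone_norm K f (- x) = cone_norm K f x"
proof -
  have "cone_norm K f (- x) \<le> cone_norm K f x" for x
  proof (rule cone_norm_geI)
    fix v w assume "v \<in> K" "w \<in> K" "x = v - w"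
    then show "cone_norm K f (- x) \<le> f \<bullet> (v + w)"
      using cone_norm_le[of w v] by (simp add: add.commute)
  qed
  from this[of x] this[of "- x"] show ?thesis
    by simp
qed

lemma cone_norm_zero: "cone_norm K f 0 = 0"
  using cone_norm_eq[OF zero_mem] by simp

lemma cone_norm_scale_le:
  assumes "c > 0"
  shows "cone_norm K f (c *\<^sub>R x) \<le> c * cone_norm K f x"
proof -
  have "cone_norm K f (c *\<^sub>R x) / c \<le> cone_norm K f x"
  proof (rule cone_norm_geI)
    fix v w assume "v \<in> K" "w \<in> K" "x = v - w"
    then have "cone_norm K f (c *\<^sub>R x) \<le> c * (f \<bullet> (v + w))"
      using cone_norm_le[of "c *\<^sub>R v" "c *\<^sub>R w"] scale_mem assms
      by (simp add: scaleR_diff_right inner_add_right distrib_left)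
    then show "cone_norm K f (c *\<^sub>R x) / c \<le> f \<bullet> (v + w)"
      using assms by (simp add: field_simps)
  qed
  then show ?thesis
    using assms by (simp add: field_simps)
qed

lemma cone_norm_scale: "cone_norm K f (c *\<^sub>R x) = \<bar>c\<bar> * cone_norm K f x"
proof -
  have pos: "cone_norm K f (d *\<^sub>R x) = d * cone_norm K f x" if "d > 0" for d x
  proof (rule antisym)
    show "cone_norm K f (d *\<^sub>R x) \<le> d * cone_norm K f x"
      using that by (rule cone_norm_scale_le)
    have "cone_norm K f ((1 / d) *\<^sub>R d *\<^sub>R x) \<le> 1 / d * cone_norm K f (d *\<^sub>R x)"
      using that by (intro cone_norm_scale_le) simp
    then show "d * cone_norm K f x \<le> cone_norm K f (d *\<^sub>R x)"
      using that by (simp add: field_simps)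
  qed
  consider "c > 0" | "c = 0" | "c < 0"
    by linarith
  then show ?thesis
  proof cases
    case 3
    then show ?thesis
      using pos[of "- c" x] cone_norm_minus[of "c *\<^sub>R x"] by simp
  qed (simp_all add: pos cone_norm_zero)
qed

lemma is_norm_cone_norm: "is_norm (cone_norm K f)"
  unfolding is_norm_def
proof (intro conjI allI)
  fix x
  show "0 \<le> cone_norm K f x"
    using cone_norm_lower[of x] b by (meson mult_nonneg_nonneg norm_ge_zero order.trans less_imp_le)
  show "cone_norm K f x = 0 \<longleftrightarrow> x = 0"
    using cone_norm_lower[of x] b cone_norm_zero by (auto simp: mult_le_0_iff)
qed (use cone_norm_scale cone_norm_triangle in auto)

lemma cone_linear_absolute_norm_cone_norm: "cone_linear_absolute_norm (cone_norm K f)"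
proof -
  have "cone_absolute K (cone_norm K f)"
    unfolding cone_absolute_def
  proof
    fix x
    \<comment> \<open>The sum \<open>v + w\<close> stays in \<open>K\<close>, where the norm equals
      \<open>f\<close>, so both infima range over the same set.\<close>
    have "{cone_norm K f (v + w) | v w. v \<in> K \<and> w \<in> K \<and> x = v - w} =
        {f \<bullet> (v + w) | v w. v \<in> K \<and> w \<in> K \<and> x = v - w}"
      by (metis (lifting) add_mem cone_norm_eq)
    then show "cone_norm K f x = Inf {cone_norm K f (v + w) | v w. v \<in> K \<and> w \<in> K \<and> x = v - w}"
      by (simp add: cone_norm_def[of K f x])
  qed
  moreover have "cone_linear K (cone_norm K f)"
    unfolding cone_linear_def dual_cone_def using nonneg cone_norm_eq by auto
  ultimately show ?thesis
    unfolding cone_linear_absolute_norm_def using is_norm_cone_norm K by blast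
qed

text \<open>A finite convex function on a finite-dimensional space is continuous. This later
  supplies the integrability of the norm at a random argument.\<close>

lemma continuous_cone_norm: "continuous_on UNIV (cone_norm K f)"
proof (rule convex_on_continuous)
  show "convex_on UNIV (cone_norm K f)"
  proof (rule convex_onI)
    fix t x y assume "0 < (t::real)" "t < 1"
    then show "cone_norm K f ((1 - t) *\<^sub>R x + t *\<^sub>R y) \<le>
        (1 - t) * cone_norm K f x + t * cone_norm K f y"
      using cone_norm_triangle[of "(1 - t) *\<^sub>R x" "t *\<^sub>R y"] by (simp add: cone_norm_scale)
  qed simp
qed simp

end

section \<open>Tensor powers of matrices and cones\<close>

text \<open>The factors may differ from slot to slot, as needed for rows of Kronecker matrices and
  for products of different dual functionals. Only the slots below \<open>p\<close> matter.\<close>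

definition elementary_tensor ::
    "('m::finite \<Rightarrow> nat \<Rightarrow> 'n::finite) \<Rightarrow> nat \<Rightarrow> (nat \<Rightarrow> real^'n) \<Rightarrow> real^'m" where
  "elementary_tensor idx p x = (\<chi> i. \<Prod>s<p. x s $ idx i s)"

lemma kron_power_eq: "kron_power idx p x = elementary_tensor idx p (\<lambda>_. x)"
  by (simp add: kron_power_def elementary_tensor_def)

text \<open>Multi-indices are extensional functions on \<open>{..<p}\<close>, so agreement below
  \<open>p\<close> already makes them equal.\<close>

lemma multi_indexing_inj:
  assumes idx: "multi_indexing p idx" and eq: "\<And>s. s < p \<Longrightarrow> idx i s = idx j s"
  shows "i = j"
proof -
  have "idx i \<in> {..<p} \<rightarrow>\<^sub>E UNIV" "idx j \<in> {..<p} \<rightarrow>\<^sub>E UNIV"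
    using idx unfolding multi_indexing_def bij_betw_def by auto
  then have "idx i = idx j"
    using eq by (intro PiE_ext) auto
  then show ?thesis
    using idx unfolding multi_indexing_def bij_betw_def inj_def by blast
qed

text \<open>Row \<open>i\<close> is the tensor product of the rows \<open>idx i s\<close> of
  \<open>M\<close>. In this form, applying the matrix to an elementary tensor is an instance of the
  inner product formula.\<close>

definition kron_matrix :: "('m::finite \<Rightarrow> nat \<Rightarrow> 'n::finite) \<Rightarrow> nat \<Rightarrow> real^'n^'n \<Rightarrow> real^'m^'m" where
  "kron_matrix idx p M = (\<chi> i. elementary_tensor idx p (\<lambda>s. M $ idx i s))"

text \<open>The bijection turns the sum over coordinates into a sum over all multi-indices, which
  the distributive law factors into a product of sums.\<close>

lemma inner_elementary_tensor:
  assumes "multi_indexing p (idx :: 'm::finite \<Rightarrow> nat \<Rightarrow> 'n::finite)"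
  shows "elementary_tensor idx p u \<bullet> elementary_tensor idx p v = (\<Prod>s<p. u s \<bullet> v s)"
proof -
  have "elementary_tensor idx p u \<bullet> elementary_tensor idx p v =
      (\<Sum>i\<in>UNIV. \<Prod>s<p. u s $ idx i s * v s $ idx i s)"
    by (simp add: inner_vec_def elementary_tensor_def prod.distrib)
  also have "\<dots> = (\<Sum>g\<in>{..<p} \<rightarrow>\<^sub>E UNIV. \<Prod>s<p. u s $ g s * v s $ g s)"
    using sum.reindex_bij_betw[OF assms[unfolded multi_indexing_def],
        of "\<lambda>g. \<Prod>s<p. u s $ g s * v s $ g s"] .
  also have "\<dots> = (\<Prod>s<p. \<Sum>j\<in>UNIV. u s $ j * v s $ j)"
    by (rule prod_sum_PiE[symmetric]) auto
  finally show ?thesis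
    by (simp add: inner_vec_def)
qed

lemma norm_elementary_tensor:
  assumes "multi_indexing p idx"
  shows "norm (elementary_tensor idx p u) = (\<Prod>s<p. norm (u s))"
proof (rule power2_eq_imp_eq)
  show "(norm (elementary_tensor idx p u))\<^sup>2 = (\<Prod>s<p. norm (u s))\<^sup>2"
    by (simp add: power2_norm_eq_inner inner_elementary_tensor[OF assms] prod_power_distrib)
qed (simp_all add: prod_nonneg)

lemma kron_matrix_elementary_tensor:
  assumes "multi_indexing p idx"
  shows "kron_matrix idx p M *v elementary_tensor idx p u = elementary_tensor idx p (\<lambda>s. M *v u s)"
  using inner_elementary_tensor[OF assms]
  by (simp add: vec_eq_iff matrix_vector_mul_component kron_matrix_def)
     (simp add: elementary_tensor_def matrix_vector_mul_component)

lemma kron_matrix_mult: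
  assumes "multi_indexing p idx"
  shows "kron_matrix idx p (M ** N) = kron_matrix idx p M ** kron_matrix idx p N"
proof -
  have "(kron_matrix idx p M ** kron_matrix idx p N) $ i $ j = kron_matrix idx p (M ** N) $ i $ j"
    for i j
  proof -
    \<comment> \<open>Each entry of the product is an inner product of two elementary tensors, one
      made of rows of \<open>M\<close> and one of columns of \<open>N\<close>.\<close>
    have "(kron_matrix idx p M ** kron_matrix idx p N) $ i $ j =
        elementary_tensor idx p (\<lambda>s. M $ idx i s) \<bullet> elementary_tensor idx p (\<lambda>s. column (idx j s) N)"
      by (simp add: matrix_matrix_mult_def kron_matrix_def elementary_tensor_def column_def inner_vec_def)
    then show ?thesis
      unfolding inner_elementary_tensor[OF assms]
      by (simp add: matrix_matrix_mult_def kron_matrix_def elementary_tensor_def column_def inner_vec_def)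
  qed
  then show ?thesis
    by (simp add: vec_eq_iff)
qed

lemma kron_matrix_one:
  assumes "multi_indexing p (idx :: 'm::finite \<Rightarrow> nat \<Rightarrow> 'n::finite)"
  shows "kron_matrix idx p (mat 1) = mat 1"
proof -
  have "kron_matrix idx p (mat 1) $ i $ j = mat 1 $ i $ j" for i j
  proof (cases "i = j")
    case False
    then have "\<exists>s<p. idx i s \<noteq> idx j s"
      using multi_indexing_inj[OF assms] by blast
    then show ?thesis
      using False by (auto simp: kron_matrix_def elementary_tensor_def mat_def intro!: bexI)
  qed (simp add: kron_matrix_def elementary_tensor_def mat_def)
  then show ?thesis
    by (simp add: vec_eq_iff)
qed

lemma transpose_kron_matrix: "transpose (kron_matrix idx p M) = kron_matrix idx p (transpose M)"
  by (simp add: vec_eq_iff transpose_def kron_matrix_def elementary_tensor_def)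

text \<open>Summing the row norms costs the factor \<open>CARD('m)\<close>, which is harmless:
  constant factors do not affect exponential growth rates.\<close>

lemma norm_kron_matrix_le:
  assumes "multi_indexing p (idx :: 'm::finite \<Rightarrow> nat \<Rightarrow> 'n::finite)"
  shows "norm (kron_matrix idx p M) \<le> real CARD('m) * norm M ^ p"
proof -
  have "norm (kron_matrix idx p M) \<le> (\<Sum>i\<in>UNIV. norm (kron_matrix idx p M $ i))"
    unfolding norm_vec_def[of "kron_matrix idx p M"] by (rule L2_set_le_sum) simp
  also have "\<dots> \<le> (\<Sum>i\<in>(UNIV::'m set). norm M ^ p)"
  proof (rule sum_mono)
    fix i
    have "norm (kron_matrix idx p M $ i) = (\<Prod>s<p. norm (M $ idx i s))"
      by (simp add: kron_matrix_def norm_elementary_tensor[OF assms])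
    also have "\<dots> \<le> (\<Prod>s<p. norm M)"
      by (intro prod_mono conjI norm_ge_zero Finite_Cartesian_Product.norm_nth_le)
    finally show "norm (kron_matrix idx p M $ i) \<le> norm M ^ p"
      by simp
  qed
  finally show ?thesis
    by simp
qed

lemma continuous_kron_matrix: "continuous_on UNIV (kron_matrix idx p)"
  unfolding kron_matrix_def elementary_tensor_def
  by (intro continuous_intros)

section \<open>The tensor cone: invariance and properness\<close>

text \<open>
  Among the tensor products of \<open>p\<close> copies of \<open>K\<close> this is the largest one. Being defined by
  inequalities it is closed without further argument, which is not clear for the cone generated by
  the elementary tensors of elements of \<open>K\<close>.
\<close>

definition tensor_cone ::
    "('m::finite \<Rightarrow> nat \<Rightarrow> 'n::finite) \<Rightarrow> nat \<Rightarrow> (real^'n) set \<Rightarrow> (real^'m) set" where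
  "tensor_cone idx p K =
     {y. \<forall>f. (\<forall>s. f s \<in> dual_cone K) \<longrightarrow> 0 \<le> elementary_tensor idx p f \<bullet> y}"

lemma inner_matrix_vector_mult:
  fixes A :: "real^'n^'m"
  shows "x \<bullet> (A *v y) = (transpose A *v x) \<bullet> y"
  by (simp add: dot_lmul_matrix transpose_matrix_vector)

text \<open>Transposition moves the matrix onto the test functionals, and \<open>transpose M\<close>
  preserves the dual cone because \<open>M\<close> preserves \<open>K\<close>.\<close>

lemma kron_matrix_tensor_cone:
  fixes idx :: "'m::finite \<Rightarrow> nat \<Rightarrow> 'n::finite"
  assumes idx: "multi_indexing p idx" and M: "(\<lambda>x. M *v x) ` K \<subseteq> K" and y: "y \<in> tensor_cone idx p K"
  shows "kron_matrix idx p M *v y \<in> tensor_cone idx p K"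
  unfolding tensor_cone_def
proof (intro CollectI allI impI)
  fix f :: "nat \<Rightarrow> real^'n" assume f: "\<forall>s. f s \<in> dual_cone K"
  have "\<forall>s. transpose M *v f s \<in> dual_cone K"
  proof
    fix s
    show "transpose M *v f s \<in> dual_cone K"
      using f[rule_format, of s] M unfolding dual_cone_def
      by (simp add: image_subset_iff flip: inner_matrix_vector_mult del: transpose_matrix_vector)
  qed
  moreover have "elementary_tensor idx p f \<bullet> (kron_matrix idx p M *v y) =
      elementary_tensor idx p (\<lambda>s. transpose M *v f s) \<bullet> y"
    by (simp add: inner_matrix_vector_mult transpose_kron_matrix kron_matrix_elementary_tensor[OF idx])
  ultimately show "0 \<le> elementary_tensor idx p f \<bullet> (kron_matrix idx p M *v y)"
    using y unfolding tensor_cone_def by simp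
qed

lemma elementary_tensor_slot_diff:
  fixes idx :: "'m::finite \<Rightarrow> nat \<Rightarrow> 'n::finite"
  assumes "k < p"
  shows "elementary_tensor idx p (f(k := c *\<^sub>R (u - v))) =
    c *\<^sub>R (elementary_tensor idx p (f(k := u)) - elementary_tensor idx p (f(k := v)))"
proof -
  have "(\<Prod>s<p. (f(k := w)) s $ idx i s) = w $ idx i k * (\<Prod>s\<in>{..<p} - {k}. f s $ idx i s)"
    for w i
    using assms by (simp add: prod.remove[of _ k])
  then show ?thesis
    by (simp add: vec_eq_iff elementary_tensor_def algebra_simps)
qed

text \<open>The dual cone has an interior point \<open>e\<close>, so its differences, suitably
  scaled, fill the whole space. By multilinearity the slots can be freed one at a time until unit
  vectors are allowed in all of them, which reads off the coordinates of \<open>y\<close>.\<close>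

lemma elementary_tensors_dual_cone_separate:
  fixes idx :: "'m::finite \<Rightarrow> nat \<Rightarrow> 'n::finite"
  assumes idx: "multi_indexing p idx" and K: "proper_cone K"
    and y: "\<And>f. (\<And>s. f s \<in> dual_cone K) \<Longrightarrow> elementary_tensor idx p f \<bullet> y = 0"
  shows "y = 0"
proof -
  obtain e b where b: "b > 0" and e: "\<And>x. x \<in> K \<Longrightarrow> b * norm x \<le> e \<bullet> x"
    using pointed_cone_separation[of K] K unfolding proper_cone_def by metis
  have near: "e + d \<in> dual_cone K" if "norm d \<le> b" for d
    unfolding dual_cone_def
  proof (intro CollectI ballI)
    fix x assume "x \<in> K"
    have "- (d \<bullet> x) \<le> norm d * norm x"
      using norm_cauchy_schwarz[of "- d" x] by simp
    also have "\<dots> \<le> b * norm x"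
      using that by (simp add: mult_right_mono)
    finally show "0 \<le> (e + d) \<bullet> x"
      using e[OF \<open>x \<in> K\<close>] by (simp add: inner_add_left)
  qed
  have span: "\<exists>c d. d \<in> dual_cone K \<and> u = c *\<^sub>R (d - e)" for u :: "real^'n"
  proof (cases "u = 0")
    case False
    then have "norm ((b / norm u) *\<^sub>R u) \<le> b"
      using b by simp
    from near[OF this] show ?thesis
      using False b by (intro exI[of _ "norm u / b"] exI[of _ "e + (b / norm u) *\<^sub>R u"]) simp
  qed (use near[of 0] b in \<open>auto intro!: exI[of _ 0] exI[of _ e]\<close>)
  have e': "e \<in> dual_cone K"
    using near[of 0] b by simp
  \<comment> \<open>The first \<open>k\<close> slots are arbitrary, the others still dual; the
    induction step splits slot \<open>k\<close> into a scaled difference of dual elements.\<close>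
  have partial: "elementary_tensor idx p f \<bullet> y = 0"
    if "k \<le> p" "\<And>s. s \<ge> k \<Longrightarrow> f s \<in> dual_cone K" for k f
    using that
  proof (induction k arbitrary: f)
    case 0
    then show ?case
      using y by simp
  next
    case (Suc k)
    obtain c d where d: "d \<in> dual_cone K" and fk: "f k = c *\<^sub>R (d - e)"
      using span by blast
    have "elementary_tensor idx p (f(k := u)) \<bullet> y = 0" if "u \<in> dual_cone K" for u
      using Suc.prems that by (intro Suc.IH) auto
    then have "elementary_tensor idx p (f(k := c *\<^sub>R (d - e))) \<bullet> y = 0"
      using Suc.prems(1) d e' by (simp add: elementary_tensor_slot_diff inner_diff_left)
    then show ?case
      by (metis fk fun_upd_triv)
  qed
  have "y $ i = 0" for i
  proof -
    \<comment> \<open>Slots from \<open>p\<close> on do not change the tensor, but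
      \<open>partial\<close> asks for dual elements there.\<close>
    let ?f = "\<lambda>s. if s < p then axis (idx i s) 1 else e"
    have "elementary_tensor idx p ?f = axis i 1"
    proof -
      have "(\<Prod>s<p. ?f s $ idx i' s) = axis i 1 $ i'" for i'
      proof (cases "i' = i")
        case True
        then show ?thesis
          by (simp add: axis_def)
      next
        case False
        then obtain s where "s < p" "idx i' s \<noteq> idx i s"
          using multi_indexing_inj[OF idx] by blast
        then show ?thesis
          using False by (auto simp: axis_def intro!: bexI[of _ s])
      qed
      then show ?thesis
        by (simp add: elementary_tensor_def vec_eq_iff)
    qed
    moreover have "elementary_tensor idx p ?f \<bullet> y = 0"
      by (rule partial[of p]) (use e' in auto)
    ultimately show ?thesis
      by (simp add: inner_axis')
  qed
  then show ?thesis
    by (simp add: vec_eq_iff)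
qed

text \<open>A dual functional \<open>g\<close> satisfies
  \<open>r * norm g \<le> g \<bullet> e\<close>. Multiplying over the slots, the value of a test
  tensor at the power of \<open>e\<close> is at least \<open>r ^ p\<close> times its norm, which
  absorbs any perturbation of norm at most \<open>r ^ p\<close>.\<close>

lemma elementary_tensor_interior:
  fixes idx :: "'m::finite \<Rightarrow> nat \<Rightarrow> 'n::finite"
  assumes idx: "multi_indexing p idx" and r: "r > 0" "cball e r \<subseteq> K"
  shows "elementary_tensor idx p (\<lambda>_. e) \<in> interior (tensor_cone idx p K)"
proof -
  have pair: "r * norm g \<le> g \<bullet> e" if "g \<in> dual_cone K" for g
  proof (cases "g = 0")
    case False
    \<comment> \<open>This is the point of the ball at which \<open>g\<close> is smallest.\<close>
    have "e - (r / norm g) *\<^sub>R g \<in> K"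
      using r False by (intro subsetD[OF r(2)]) (simp add: dist_norm)
    then have "0 \<le> g \<bullet> (e - (r / norm g) *\<^sub>R g)"
      using that unfolding dual_cone_def by blast
    also have "\<dots> = g \<bullet> e - r * norm g"
      using False by (simp add: inner_diff_right power2_norm_eq_inner[symmetric] power2_eq_square)
    finally show ?thesis
      by simp
  qed simp
  have "cball (elementary_tensor idx p (\<lambda>_. e)) (r ^ p) \<subseteq> tensor_cone idx p K"
  proof
    fix y assume "y \<in> cball (elementary_tensor idx p (\<lambda>_. e)) (r ^ p)"
    then have dist: "norm (elementary_tensor idx p (\<lambda>_. e) - y) \<le> r ^ p"
      by (simp add: dist_norm)
    show "y \<in> tensor_cone idx p K"
      unfolding tensor_cone_def
    proof (intro CollectI allI impI)
      fix f :: "nat \<Rightarrow> real^'n" assume f: "\<forall>s. f s \<in> dual_cone K"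
      let ?t = "elementary_tensor idx p"
      have "?t f \<bullet> (?t (\<lambda>_. e) - y) \<le> norm (?t f) * norm (?t (\<lambda>_. e) - y)"
        by (rule norm_cauchy_schwarz)
      also have "\<dots> \<le> norm (?t f) * r ^ p"
        using dist by (simp add: mult_left_mono)
      also have "\<dots> = (\<Prod>s<p. r * norm (f s))"
        by (simp add: norm_elementary_tensor[OF idx] prod.distrib)
      also have "\<dots> \<le> (\<Prod>s<p. f s \<bullet> e)"
        using f r(1) by (intro prod_mono conjI pair) auto
      also have "\<dots> = ?t f \<bullet> ?t (\<lambda>_. e)"
        by (simp add: inner_elementary_tensor[OF idx])
      finally show "0 \<le> ?t f \<bullet> y"
        by (simp add: inner_diff_right)
    qed
  qed
  then show ?thesis
    using r(1) by (meson mem_interior_cball zero_less_power)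
qed

lemma proper_cone_tensor_cone:
  fixes idx :: "'m::finite \<Rightarrow> nat \<Rightarrow> 'n::finite"
  assumes idx: "multi_indexing p idx" and K: "proper_cone K"
  shows "proper_cone (tensor_cone idx p K)"
proof -
  have halfspaces: "tensor_cone idx p K =
      (\<Inter>f\<in>{f. \<forall>s. f s \<in> dual_cone K}. {y. 0 \<le> elementary_tensor idx p f \<bullet> y})"
    by (auto simp: tensor_cone_def)
  have "cone (tensor_cone idx p K)"
    by (auto simp: cone_def tensor_cone_def)
  moreover have "closed (tensor_cone idx p K)"
    unfolding halfspaces by (intro closed_INT ballI closed_Collect_le continuous_intros)
  moreover have "convex (tensor_cone idx p K)"
    unfolding halfspaces using convex_halfspace_ge by (intro convex_INT) simp
  moreover have "interior (tensor_cone idx p K) \<noteq> {}"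
  proof -
    obtain e where "e \<in> interior K"
      using K unfolding proper_cone_def by blast
    then obtain r where "r > 0" "cball e r \<subseteq> K"
      by (meson mem_interior_cball)
    then show ?thesis
      using elementary_tensor_interior[OF idx] by blast
  qed
  moreover have "y = 0" if "y \<in> tensor_cone idx p K" "- y \<in> tensor_cone idx p K" for y
  proof (rule elementary_tensors_dual_cone_separate[OF idx K])
    fix f :: "nat \<Rightarrow> real^'n" assume "\<And>s. f s \<in> dual_cone K"
    then show "elementary_tensor idx p f \<bullet> y = 0"
      using that unfolding tensor_cone_def by (auto intro: antisym)
  qed
  ultimately show ?thesis
    unfolding proper_cone_def by blast
qed


section \<open>Submultiplicative sequences and matrix norms\<close>

lemma le_power_of_powr_inverse_le:
  fixes x c :: real
  assumes "0 \<le> x" "n > 0" "x powr (1 / real n) \<le> c"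
  shows "x \<le> c ^ n"
proof (cases "x = 0")
  case True
  then show ?thesis
    using assms by simp
next
  case False
  have "x = (x powr (1 / real n)) ^ n"
    using assms False by (simp add: powr_power)
  also have "\<dots> \<le> c ^ n"
    using assms by (intro power_mono) auto
  finally show ?thesis .
qed

text \<open>Fekete's lemma in multiplicative form: the limit is the infimum \<open>L\<close> over
  \<open>k \<ge> 1\<close>. For \<open>c > L\<close> choose \<open>m\<close> with
  \<open>r m < c\<close>; division of \<open>k\<close> by \<open>m\<close> with remainder gives
  \<open>a k \<le> D * c ^ k\<close>, and the \<open>k\<close>-th root of \<open>D\<close> tends to
  1.\<close>

lemma fekete_submultiplicative:
  fixes a :: "nat \<Rightarrow> real"
  assumes nonneg: "\<And>k. 0 \<le> a k" and submult: "\<And>k l. a (k + l) \<le> a k * a l"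
  shows "convergent (\<lambda>k. a k powr (1 / real k))"
proof -
  define r where "r k = a k powr (1 / real k)" for k
  define L where "L = Inf (r ` {1..})"
  have "bdd_below (r ` {1..})"
    by (intro bdd_belowI[of _ 0]) (auto simp: r_def)
  then have L_le: "L \<le> r k" if "k \<ge> 1" for k
    unfolding L_def using that by (intro cInf_lower) auto
  have "r \<longlonglongrightarrow> L"
  proof (rule order_tendstoI)
    fix u assume "u < L"
    then show "eventually (\<lambda>k. u < r k) sequentially"
      using L_le by (intro eventually_sequentiallyI[of 1]) (meson less_le_trans)
  next
    fix u assume "L < u"
    then obtain c where c: "L < c" "c < u"
      using dense by blast
    then obtain m where m: "m \<ge> 1" "r m < c"
      unfolding L_def using cInf_lessD[of "r ` {1..}" c] by auto
    have "c > 0"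
      using m(2) by (metis r_def le_less_trans powr_ge_zero)
    have am: "a m \<le> c ^ m"
      using m nonneg by (intro le_power_of_powr_inverse_le) (auto simp: r_def)
    \<comment> \<open>The sum dominates the quotient for every remainder \<open>s < m\<close>; the 1
      keeps \<open>D\<close> positive, so that its roots tend to 1.\<close>
    define D where "D = 1 + (\<Sum>s<m. a s / c ^ s)"
    have "D \<ge> 1"
      using nonneg \<open>c > 0\<close> by (auto simp: D_def intro!: sum_nonneg)
    have D: "a s \<le> D * c ^ s" if "s < m" for s
    proof -
      have "a s / c ^ s \<le> (\<Sum>s<m. a s / c ^ s)"
        using that nonneg \<open>c > 0\<close> by (intro member_le_sum) auto
      then have "a s / c ^ s \<le> D"
        by (simp add: D_def)
      then show ?thesis
        using \<open>c > 0\<close> by (simp add: divide_le_eq)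
    qed
    have step: "a (m * q + s) \<le> D * c ^ (m * q + s)" if "s < m" for q s
    proof (induction q)
      case 0
      then show ?case
        using D[OF that] by simp
    next
      case (Suc q)
      have "a (m * Suc q + s) \<le> a m * a (m * q + s)"
        using submult[of m "m * q + s"] by (simp add: add.assoc)
      also have "\<dots> \<le> c ^ m * (D * c ^ (m * q + s))"
        using am Suc nonneg \<open>c > 0\<close> by (intro mult_mono) auto
      finally show ?case
        by (simp add: power_add mult_ac)
    qed
    have bound: "a k \<le> D * c ^ k" for k
      using step[of "k mod m" "k div m"] m(1) by (simp add: mult_div_mod_eq)
    have "(\<lambda>k. D powr (1 / real k) * c) \<longlonglongrightarrow> D powr 0 * c"
      using \<open>D \<ge> 1\<close> by (intro tendsto_intros lim_1_over_n) auto
    then have ev: "eventually (\<lambda>k. D powr (1 / real k) * c < u) sequentially"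
      using \<open>D \<ge> 1\<close> c(2) by (intro order_tendstoD(2)) auto
    have r_le: "r k \<le> D powr (1 / real k) * c" if "k \<ge> 1" for k
    proof -
      have "r k \<le> (D * c ^ k) powr (1 / real k)"
        unfolding r_def using bound nonneg by (intro powr_mono2) auto
      also have "\<dots> = D powr (1 / real k) * (c powr real k) powr (1 / real k)"
        using \<open>D \<ge> 1\<close> \<open>c > 0\<close> by (simp add: powr_mult powr_realpow)
      also have "(c powr real k) powr (1 / real k) = c"
        using that \<open>c > 0\<close> by (simp only: powr_powr) simp
      finally show ?thesis .
    qed
    show "eventually (\<lambda>k. r k < u) sequentially"
      using ev eventually_ge_at_top[of 1] by eventually_elim (rule le_less_trans[OF r_le])
  qed
  then show ?thesis
    unfolding r_def by (rule convergentI)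
qed

section \<open>The Frobenius norm and continuity of matrix products\<close>

lemma norm_matrix_vector_mult_le:
  fixes A :: "real^'n^'m"
  shows "norm (A *v x) \<le> norm A * norm x"
proof -
  have "norm (A *v x) \<le> L2_set (\<lambda>i. norm (A $ i) * norm x) UNIV"
    unfolding norm_vec_def[of "A *v x"]
    by (intro L2_set_mono) (auto simp: matrix_vector_mul_component Cauchy_Schwarz_ineq2)
  also have "\<dots> = norm A * norm x"
    by (simp add: norm_vec_def[of A] L2_set_left_distrib)
  finally show ?thesis .
qed

lemma norm_transpose:
  fixes A :: "real^'n^'m"
  shows "norm (transpose A) = norm A"
  using sum.swap[of "\<lambda>i j. (A $ i $ j)\<^sup>2" UNIV UNIV]
  by (simp add: norm_vec_def L2_set_def transpose_def sum_nonneg)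

lemma norm_matrix_matrix_mult_le:
  fixes A :: "real^'n^'m" and B :: "real^'k^'n"
  shows "norm (A ** B) \<le> norm A * norm B"
proof -
  have "(A ** B) $ i = transpose B *v A $ i" for i
    by (simp add: vec_eq_iff matrix_matrix_mult_def matrix_vector_mult_def transpose_def mult.commute
        del: transpose_matrix_vector)
  then have "norm ((A ** B) $ i) \<le> norm (A $ i) * norm B" for i
    by (metis mult.commute norm_matrix_vector_mult_le norm_transpose)
  then have "norm (A ** B) \<le> L2_set (\<lambda>i. norm (A $ i) * norm B) UNIV"
    unfolding norm_vec_def[of "A ** B"] by (intro L2_set_mono) auto
  also have "\<dots> = norm A * norm B"
    by (simp add: norm_vec_def[of A] L2_set_left_distrib)
  finally show ?thesis .
qed

lemma continuous_on_matrix_matrix_mult: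
  fixes f :: "'a::topological_space \<Rightarrow> real^'n^'m" and g :: "'a \<Rightarrow> real^'k^'n"
  assumes "continuous_on S f" "continuous_on S g"
  shows "continuous_on S (\<lambda>x. f x ** g x)"
  unfolding matrix_matrix_mult_def using assms by (intro continuous_intros)

lemma continuous_on_matrix_vector_mult:
  fixes f :: "'a::topological_space \<Rightarrow> real^'n^'m"
  assumes "continuous_on S f" "continuous_on S g"
  shows "continuous_on S (\<lambda>x. f x *v g x)"
  unfolding matrix_vector_mult_def using assms by (intro continuous_intros)

text \<open>The complement of the support is a union of open null sets, and by the Lindelof property
  countably many of them suffice.\<close>

lemma AE_in_supp:
  fixes \<mu> :: "'a::second_countable_topology measure"
  assumes "sets \<mu> = sets borel"
  shows "AE x in \<mu>. x \<in> supp \<mu>"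
proof -
  let ?\<F> = "{U. open U \<and> emeasure \<mu> U = 0}"
  obtain \<F>' where \<F>': "\<F>' \<subseteq> ?\<F>" "countable \<F>'" "\<Union>\<F>' = \<Union>?\<F>"
    using Lindelof[of ?\<F>] by auto
  have "(\<Union>U\<in>\<F>'. U) \<in> null_sets \<mu>"
    using \<F>'(1,2) assms by (intro null_sets_UN') (auto simp: null_sets_def)
  then have "\<Union>\<F>' \<in> null_sets \<mu>"
    by simp
  moreover have "{x \<in> space \<mu>. x \<notin> supp \<mu>} \<subseteq> \<Union>\<F>'"
    unfolding \<F>'(3) by (auto simp: supp_def)
  ultimately show ?thesis
    by (rule AE_I')
qed

section \<open>Moments of random matrix products\<close>

text \<open>
  Starting at position \<open>0\<close>, unlike \<^const>\<open>matrix_product\<close>, makes the products split along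
  \<^const>\<open>comb_seq\<close> and \<^const>\<open>case_nat\<close>.
\<close>

primrec prefix_product :: "(nat \<Rightarrow> real^'n^'n) \<Rightarrow> nat \<Rightarrow> real^'n^'n" where
  "prefix_product \<omega> 0 = mat 1"
| "prefix_product \<omega> (Suc k) = \<omega> k ** prefix_product \<omega> k"

lemma matrix_product_eq_prefix_product:
  "matrix_product \<omega> k = prefix_product (\<lambda>j. \<omega> (Suc j)) k"
  by (induction k) auto

lemma prefix_product_comb_seq_first: "prefix_product (comb_seq l \<omega> \<omega>') l = prefix_product \<omega> l"
proof -
  have "prefix_product (comb_seq l \<omega> \<omega>') j = prefix_product \<omega> j" if "j \<le> l" for j
    using that by (induction j) (auto simp: comb_seq_less)
  then show ?thesis
    by simp
qed

lemma prefix_product_comb_seq: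
  "prefix_product (comb_seq l \<omega> \<omega>') (k + l) = prefix_product \<omega>' k ** prefix_product \<omega> l"
  by (induction k)
     (auto simp: prefix_product_comb_seq_first comb_seq_add matrix_mul_assoc)

text \<open>The matrix put in front of the sequence acts first, so it becomes the rightmost
  factor.\<close>

lemma prefix_product_case_nat:
  "prefix_product (case_nat A \<omega>) (Suc k) = prefix_product \<omega> k ** A"
  using prefix_product_comb_seq[of "Suc 0" "\<lambda>_. A" \<omega> k] by (simp del: prefix_product.simps(2))
     (simp add: matrix_mul_assoc)

lemma prefix_product_maps_into:
  assumes "\<And>j. (\<lambda>x. \<omega> j *v x) ` K \<subseteq> K"
  shows "(\<lambda>x. prefix_product \<omega> k *v x) ` K \<subseteq> K"
  using assms by (induction k) (auto simp flip: matrix_vector_mul_assoc)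

lemma norm_prefix_product_le:
  fixes \<omega> :: "nat \<Rightarrow> real^'n^'n"
  assumes "\<And>j. norm (\<omega> j) \<le> R"
  shows "norm (prefix_product \<omega> k) \<le> R ^ k * norm (mat 1 :: real^'n^'n)"
proof (induction k)
  case (Suc k)
  have "norm (prefix_product \<omega> (Suc k)) \<le> norm (\<omega> k) * norm (prefix_product \<omega> k)"
    by (simp add: norm_matrix_matrix_mult_le)
  also have "\<dots> \<le> R * (R ^ k * norm (mat 1 :: real^'n^'n))"
    using assms[of k] Suc by (intro mult_mono) (auto intro: order_trans[OF norm_ge_zero])
  finally show ?case
    by simp
qed simp

text \<open>The image of a closed ball under \<open>h\<close> is compact, so the composition is
  almost everywhere bounded.\<close>

lemma (in finite_measure) integrable_continuous_of_bounded:
  fixes X :: "'a \<Rightarrow> 'b::euclidean_space" and h :: "'b \<Rightarrow> 'c::{banach, second_countable_topology}"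
  assumes X: "X \<in> borel_measurable M" and h: "continuous_on UNIV h" and R: "AE x in M. norm (X x) \<le> R"
  shows "integrable M (\<lambda>x. h (X x))"
proof -
  have "compact (h ` cball 0 R)"
    using h by (intro compact_continuous_image continuous_on_subset[OF h]) auto
  then obtain C where C: "\<And>y. y \<in> cball 0 R \<Longrightarrow> norm (h y) \<le> C"
    using compact_imp_bounded bounded_iff by (metis image_eqI)
  show ?thesis
  proof (rule integrable_const_bound)
    show "AE x in M. norm (h (X x)) \<le> C"
      using R by eventually_elim (simp add: C)
    show "(\<lambda>x. h (X x)) \<in> borel_measurable M"
      using X borel_measurable_continuous_onI[OF h] by (rule measurable_compose)
  qed
qed

locale bounded_matrix_law = prob_space \<mu> for \<mu> :: "(real^'n^'n) measure" +
  assumes sets_eq: "sets \<mu> = sets borel" and bounded_supp: "bounded (supp \<mu>)"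

context bounded_matrix_law
begin

lemma sequence_space: "sequence_space \<mu>"
  by unfold_locales

lemma prob_space_switching_law: "prob_space (switching_law \<mu>)"
  unfolding switching_law_def by (rule prob_space_PiM) (rule prob_space_axioms)

lemma measurable_coordinate: "(\<lambda>\<omega>. \<omega> j) \<in> borel_measurable (switching_law \<mu>)"
  unfolding switching_law_def
  by (subst measurable_cong_sets[OF refl sets_eq[symmetric]]) (rule measurable_component_singleton, simp)

text \<open>The shift \<open>s\<close> covers both conventions: 0 for \<open>prefix_product\<close>
  and 1 for \<open>matrix_product\<close>.\<close>

lemma measurable_prefix_product:
  "(\<lambda>\<omega>. prefix_product (\<lambda>j. \<omega> (s + j)) k) \<in> borel_measurable (switching_law \<mu>)"
proof (induction k)
  case (Suc k)
  have "continuous_on UNIV (\<lambda>x. fst x ** snd x :: real^'n^'n)"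
    by (intro continuous_on_matrix_matrix_mult continuous_intros)
  from borel_measurable_continuous_Pair[OF measurable_coordinate Suc this] show ?case
    by simp
qed simp

lemma AE_coordinates_in_supp: "AE \<omega> in switching_law \<mu>. \<forall>j. \<omega> j \<in> supp \<mu>"
  unfolding AE_all_countable switching_law_def
  using AE_in_supp[OF sets_eq] by (intro allI AE_PiM_component) (auto simp: prob_space_axioms)

lemma integrable_prefix_product:
  fixes h :: "real^'n^'n \<Rightarrow> 'c::{banach, second_countable_topology}"
  assumes h: "continuous_on UNIV h"
  shows "integrable (switching_law \<mu>) (\<lambda>\<omega>. h (prefix_product (\<lambda>j. \<omega> (s + j)) k))"
proof -
  interpret S: prob_space "switching_law \<mu>"
    by (rule prob_space_switching_law)
  obtain R where R: "\<And>A. A \<in> supp \<mu> \<Longrightarrow> norm A \<le> R"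
    using bounded_supp unfolding bounded_iff by blast
  have "AE \<omega> in switching_law \<mu>. norm (prefix_product (\<lambda>j. \<omega> (s + j)) k) \<le>
      R ^ k * norm (mat 1 :: real^'n^'n)"
    using AE_coordinates_in_supp by eventually_elim (simp add: norm_prefix_product_le R)
  then show ?thesis
    by (rule S.integrable_continuous_of_bounded[OF measurable_prefix_product h])
qed

lemmas integrable_prefix_product_0 = integrable_prefix_product[where s = 0, simplified]

lemma integrable_continuous:
  fixes h :: "real^'n^'n \<Rightarrow> 'c::{banach, second_countable_topology}"
  assumes h: "continuous_on UNIV h"
  shows "integrable \<mu> h"
proof -
  obtain R where R: "\<And>A. A \<in> supp \<mu> \<Longrightarrow> norm A \<le> R"
    using bounded_supp unfolding bounded_iff by blast
  then have "AE A in \<mu>. norm A \<le> R"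
    using AE_in_supp[OF sets_eq] by (auto elim: eventually_mono)
  then show ?thesis
    by (intro integrable_continuous_of_bounded[OF _ h]) (simp_all add: measurable_ident_sets sets_eq)
qed

text \<open>Prepending an independent matrix with law \<open>\<mu>\<close> preserves the law of the
  sequence; Fubini then integrates the first matrix last.\<close>

lemma integral_case_nat:
  fixes g :: "(nat \<Rightarrow> real^'n^'n) \<Rightarrow> 'c::{banach, second_countable_topology}"
  assumes g: "integrable (switching_law \<mu>) g"
  shows "(\<integral>\<omega>. g \<omega> \<partial>switching_law \<mu>) = (\<integral>A. (\<integral>\<omega>. g (case_nat A \<omega>) \<partial>switching_law \<mu>) \<partial>\<mu>)"
proof -
  interpret pair: pair_prob_space \<mu> "switching_law \<mu>"
    unfolding pair_prob_space_def pair_sigma_finite_def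
    using prob_space_switching_law prob_space_axioms
    by (simp add: prob_space_imp_sigma_finite)
  let ?c = "\<lambda>(A, \<omega>). case_nat A \<omega> :: nat \<Rightarrow> real^'n^'n"
  have c[measurable]: "?c \<in> \<mu> \<Otimes>\<^sub>M switching_law \<mu> \<rightarrow>\<^sub>M switching_law \<mu>"
    unfolding switching_law_def by measurable
  have law: "distr (\<mu> \<Otimes>\<^sub>M switching_law \<mu>) (switching_law \<mu>) ?c = switching_law \<mu>"
    unfolding switching_law_def by (rule sequence_space.PiM_iter[OF sequence_space])
  have [measurable]: "g \<in> borel_measurable (switching_law \<mu>)"
    using g by simp
  have "integrable (\<mu> \<Otimes>\<^sub>M switching_law \<mu>) (\<lambda>x. g (?c x))"
    using g by (subst integrable_distr_eq[symmetric, OF c]) (simp_all add: law)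
  from pair.integral_fst'[OF this]
  have "(\<integral>A. (\<integral>\<omega>. g (case_nat A \<omega>) \<partial>switching_law \<mu>) \<partial>\<mu>) =
      (\<integral>x. g (?c x) \<partial>(\<mu> \<Otimes>\<^sub>M switching_law \<mu>))"
    by simp
  also have "\<dots> = (\<integral>\<omega>. g \<omega> \<partial>distr (\<mu> \<Otimes>\<^sub>M switching_law \<mu>) (switching_law \<mu>) ?c)"
    by (rule integral_distr[symmetric, OF c]) simp
  finally show ?thesis
    by (simp add: law)
qed

lemma integral_matrix_product:
  fixes h :: "real^'n^'n \<Rightarrow> 'c::{banach, second_countable_topology}"
  assumes h: "continuous_on UNIV h"
  shows "(\<integral>\<omega>. h (matrix_product \<omega> k) \<partial>switching_law \<mu>) =
    (\<integral>\<omega>. h (prefix_product \<omega> k) \<partial>switching_law \<mu>)"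
proof -
  have "integrable (switching_law \<mu>) (\<lambda>\<omega>. h (matrix_product \<omega> k))"
    using integrable_prefix_product[OF h, of 1 k] by (simp add: matrix_product_eq_prefix_product)
  then show ?thesis
    \<comment> \<open>The inner integral does not depend on the first matrix, which
      \<open>matrix_product\<close> ignores.\<close>
    by (subst integral_case_nat) (simp_all add: matrix_product_eq_prefix_product prob_space)
qed

lemma integral_prefix_product_Suc:
  fixes h :: "real^'n^'n \<Rightarrow> 'c::{banach, second_countable_topology}"
  assumes h: "continuous_on UNIV h"
  shows "(\<integral>\<omega>. h (prefix_product \<omega> (Suc k)) \<partial>switching_law \<mu>) =
    (\<integral>A. (\<integral>\<omega>. h (prefix_product \<omega> k ** A) \<partial>switching_law \<mu>) \<partial>\<mu>)"
  by (subst integral_case_nat)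
     (simp_all only: integrable_prefix_product_0[OF h] prefix_product_case_nat)

section \<open>Moments and the p-radius\<close>

definition moment :: "nat \<Rightarrow> nat \<Rightarrow> real" where
  "moment p k = (\<integral>\<omega>. norm (prefix_product \<omega> k) ^ p \<partial>switching_law \<mu>)"

lemma moment_nonneg: "0 \<le> moment p k"
  by (simp add: moment_def)

text \<open>The first \<open>l\<close> factors and the following \<open>k\<close> factors are
  independent blocks with the laws of the shorter products, and the Frobenius norm is
  submultiplicative.\<close>

lemma moment_submultiplicative: "moment p (k + l) \<le> moment p k * moment p l"
proof -
  interpret S: prob_space "switching_law \<mu>"
    by (rule prob_space_switching_law)
  let ?S = "switching_law \<mu>" and ?n = "\<lambda>k \<omega>. ennreal (norm (prefix_product \<omega> k :: real^'n^'n) ^ p)"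
  \<comment> \<open>With nonnegative integrals the iteration over the two blocks needs only
    measurability.\<close>
  have moment: "ennreal (moment p k) = (\<integral>\<^sup>+\<omega>. ?n k \<omega> \<partial>?S)" for k
    unfolding moment_def
    by (subst nn_integral_eq_integral) (auto intro!: integrable_prefix_product_0 continuous_intros)
  let ?c = "\<lambda>(\<omega>, \<omega>'). comb_seq l \<omega> \<omega>' :: nat \<Rightarrow> real^'n^'n"
  have c[measurable]: "?c \<in> ?S \<Otimes>\<^sub>M ?S \<rightarrow>\<^sub>M ?S"
    unfolding switching_law_def by measurable
  have law: "distr (?S \<Otimes>\<^sub>M ?S) ?S ?c = ?S"
    unfolding switching_law_def by (rule sequence_space.PiM_comb_seq[OF sequence_space])
  have meas[measurable]: "?n k \<in> borel_measurable ?S" for k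
    using integrable_prefix_product_0[of "\<lambda>A. norm A ^ p" k] by (auto intro!: continuous_intros)
  have "ennreal (moment p (k + l)) = (\<integral>\<^sup>+\<omega>. ?n (k + l) \<omega> \<partial>distr (?S \<Otimes>\<^sub>M ?S) ?S ?c)"
    by (simp add: moment law)
  also have "\<dots> = (\<integral>\<^sup>+x. ?n (k + l) (?c x) \<partial>(?S \<Otimes>\<^sub>M ?S))"
    by (rule nn_integral_distr) (simp_all only: c meas law measurable_distr_eq1)
  also have "\<dots> = (\<integral>\<^sup>+\<omega>. \<integral>\<^sup>+\<omega>'. ?n (k + l) (comb_seq l \<omega> \<omega>') \<partial>?S \<partial>?S)"
    by (subst S.nn_integral_fst[OF measurable_compose[OF c meas], symmetric]) simp
  also have "\<dots> \<le> (\<integral>\<^sup>+\<omega>. \<integral>\<^sup>+\<omega>'. ?n k \<omega>' * ?n l \<omega> \<partial>?S \<partial>?S)"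
    by (intro nn_integral_mono)
       (auto simp: prefix_product_comb_seq simp flip: ennreal_mult power_mult_distrib
         intro!: ennreal_leI power_mono norm_matrix_matrix_mult_le)
  also have "\<dots> = (\<integral>\<^sup>+\<omega>. ?n k \<omega> \<partial>?S) * (\<integral>\<^sup>+\<omega>. ?n l \<omega> \<partial>?S)"
    by (simp only: nn_integral_multc[OF meas] nn_integral_cmult[OF meas])
  also have "\<dots> = ennreal (moment p k * moment p l)"
    by (simp add: moment[symmetric] ennreal_mult moment_nonneg)
  finally show ?thesis
    by (simp add: moment_nonneg)
qed

text \<open>Fekete's lemma shows that the \<open>lim\<close> in the definition of the radius is a
  genuine limit.\<close>

lemma p_radius_LIMSEQ:
  assumes p: "p \<ge> 1"
  shows "(\<lambda>k. moment p k powr (1 / (real p * real k))) \<longlonglongrightarrow> p_radius p \<mu>"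
proof -
  obtain L where L: "(\<lambda>k. moment p k powr (1 / real k)) \<longlonglongrightarrow> L"
    using fekete_submultiplicative[of "moment p"] moment_nonneg moment_submultiplicative
    by (auto simp: convergent_def)
  have "(\<lambda>k. (moment p k powr (1 / real k)) powr (1 / real p)) \<longlonglongrightarrow> L powr (1 / real p)"
    using p by (intro tendsto_powr' L tendsto_const) auto
  then have "(\<lambda>k. moment p k powr (1 / (real p * real k))) \<longlonglongrightarrow> L powr (1 / real p)"
    by (simp add: powr_powr mult.commute)
  moreover have "p_radius p \<mu> = lim (\<lambda>k. moment p k powr (1 / (real p * real k)))"
    unfolding p_radius_def moment_def
    by (subst integral_matrix_product) (auto intro!: continuous_intros)
  ultimately show ?thesis
    by (simp add: limI)
qed

lemma p_radius_nonneg: "p \<ge> 1 \<Longrightarrow> 0 \<le> p_radius p \<mu>"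
  by (rule LIMSEQ_le_const[OF p_radius_LIMSEQ]) auto

lemma moment_eventually_le:
  assumes p: "p \<ge> 1" and c: "p_radius p \<mu> < c"
  shows "eventually (\<lambda>k. moment p k \<le> c ^ (p * k)) sequentially"
proof -
  have "eventually (\<lambda>k. moment p k powr (1 / (real p * real k)) < c) sequentially"
    using p_radius_LIMSEQ[OF p] c by (rule order_tendstoD(2))
  then show ?thesis
    using eventually_gt_at_top[of 0]
  proof eventually_elim
    case (elim k)
    then show ?case
      using p moment_nonneg by (intro le_power_of_powr_inverse_le) auto
  qed
qed

end


section \<open>The contracted functional\<close>

context bounded_matrix_law
begin

text \<open>This is the \<open>k\<close>-th iterate of the transposed mean Kronecker power applied
  to \<open>f\<close>. Written as an expectation over random products, it inherits positivity and
  norm bounds from the integrand.\<close>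

definition dual_moment ::
    "('m::finite \<Rightarrow> nat \<Rightarrow> 'n) \<Rightarrow> nat \<Rightarrow> real^'m \<Rightarrow> nat \<Rightarrow> real^'m" where
  "dual_moment idx p f k =
     (\<integral>\<omega>. transpose (kron_matrix idx p (prefix_product \<omega> k)) *v f \<partial>switching_law \<mu>)"

definition mean_kron :: "('m::finite \<Rightarrow> nat \<Rightarrow> 'n) \<Rightarrow> nat \<Rightarrow> real^'m \<Rightarrow> real^'m" where
  "mean_kron idx p y = (\<integral>A. kron_matrix idx p A *v y \<partial>\<mu>)"

lemma continuous_kron_matrix_mult:
  "continuous_on UNIV (\<lambda>A. kron_matrix idx p A *v y)"
  by (intro continuous_on_matrix_vector_mult continuous_kron_matrix continuous_on_const)

lemma continuous_transpose_kron_matrix_mult: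
  "continuous_on UNIV (\<lambda>A. transpose (kron_matrix idx p A) *v y)"
  unfolding transpose_def kron_matrix_def elementary_tensor_def matrix_vector_mult_def
  by (intro continuous_intros)

lemma integrable_kron_matrix_mult: "integrable \<mu> (\<lambda>A. kron_matrix idx p A *v y)"
  by (rule integrable_continuous[OF continuous_kron_matrix_mult])

lemma inner_mean_kron: "g \<bullet> mean_kron idx p y = (\<integral>A. g \<bullet> (kron_matrix idx p A *v y) \<partial>\<mu>)"
  unfolding mean_kron_def by (rule integral_inner_right[symmetric]) (rule integrable_kron_matrix_mult)

lemma inner_dual_moment:
  "dual_moment idx p f k \<bullet> y =
    (\<integral>\<omega>. f \<bullet> (kron_matrix idx p (prefix_product \<omega> k) *v y) \<partial>switching_law \<mu>)"
  unfolding dual_moment_def inner_matrix_vector_mult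
  by (rule integral_inner_left[symmetric])
     (rule integrable_prefix_product_0[OF continuous_transpose_kron_matrix_mult])

text \<open>Integrating out the first matrix separates the rightmost factor of a product of length
  \<open>Suc k\<close>, and the Kronecker power is multiplicative.\<close>

lemma dual_moment_mean_kron:
  assumes idx: "multi_indexing p idx"
  shows "dual_moment idx p f k \<bullet> mean_kron idx p y = dual_moment idx p f (Suc k) \<bullet> y"
proof -
  have "continuous_on UNIV (\<lambda>A. f \<bullet> (kron_matrix idx p A *v y))"
    by (intro continuous_intros continuous_kron_matrix_mult)
  from integral_prefix_product_Suc[OF this, of k] show ?thesis
    by (simp add: inner_mean_kron inner_dual_moment kron_matrix_mult[OF idx] matrix_vector_mul_assoc
        del: prefix_product.simps)
qed

lemma norm_dual_moment_le:
  fixes idx :: "'m::finite \<Rightarrow> nat \<Rightarrow> 'n"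
  assumes idx: "multi_indexing p idx"
  shows "norm (dual_moment idx p f k) \<le> real CARD('m) * norm f * moment p k"
proof -
  have "norm (dual_moment idx p f k) \<le>
      (\<integral>\<omega>. norm (transpose (kron_matrix idx p (prefix_product \<omega> k)) *v f) \<partial>switching_law \<mu>)"
    unfolding dual_moment_def by (rule integral_norm_bound)
  also have "\<dots> \<le> (\<integral>\<omega>. real CARD('m) * norm f * norm (prefix_product \<omega> k) ^ p \<partial>switching_law \<mu>)"
  proof (rule integral_mono)
    show "integrable (switching_law \<mu>)
        (\<lambda>\<omega>. norm (transpose (kron_matrix idx p (prefix_product \<omega> k)) *v f))"
      by (intro integrable_norm integrable_prefix_product_0[OF continuous_transpose_kron_matrix_mult])
    show "integrable (switching_law \<mu>) (\<lambda>\<omega>. real CARD('m) * norm f * norm (prefix_product \<omega> k) ^ p)"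
      by (rule integrable_prefix_product_0[where h = "\<lambda>A. real CARD('m) * norm f * norm A ^ p"])
         (intro continuous_intros)
    fix \<omega>
    have "norm (transpose (kron_matrix idx p (prefix_product \<omega> k)) *v f) \<le>
        norm (kron_matrix idx p (prefix_product \<omega> k)) * norm f"
      using norm_matrix_vector_mult_le norm_transpose by metis
    also have "\<dots> \<le> real CARD('m) * norm (prefix_product \<omega> k) ^ p * norm f"
      using norm_kron_matrix_le[OF idx] by (intro mult_right_mono) auto
    finally show "norm (transpose (kron_matrix idx p (prefix_product \<omega> k)) *v f) \<le>
        real CARD('m) * norm f * norm (prefix_product \<omega> k) ^ p"
      by (simp add: mult_ac)
  qed
  finally show ?thesis
    by (simp add: moment_def)
qed

text \<open>Almost surely all matrices lie in the support, so their products preserve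
  \<open>K\<close> and the Kronecker powers preserve the tensor cone.\<close>

lemma dual_moment_nonneg:
  assumes idx: "multi_indexing p idx" and K: "\<And>M. M \<in> supp \<mu> \<Longrightarrow> (\<lambda>x. M *v x) ` K \<subseteq> K"
    and f: "f \<in> dual_cone (tensor_cone idx p K)" and y: "y \<in> tensor_cone idx p K"
  shows "0 \<le> dual_moment idx p f k \<bullet> y"
  unfolding inner_dual_moment
proof (rule integral_nonneg_AE)
  show "AE \<omega> in switching_law \<mu>. 0 \<le> f \<bullet> (kron_matrix idx p (prefix_product \<omega> k) *v y)"
    using AE_coordinates_in_supp
  proof eventually_elim
    case (elim \<omega>)
    have "kron_matrix idx p (prefix_product \<omega> k) *v y \<in> tensor_cone idx p K"
      using elim K y by (intro kron_matrix_tensor_cone[OF idx] prefix_product_maps_into) auto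
    then show ?case
      using f unfolding dual_cone_def by blast
  qed
qed

text \<open>
  The functional is \<open>\<Sum>k. \<gamma>\<^sup>-\<^sup>p\<^sup>k (B\<^sup>T)\<^sup>k f\<close> with \<open>B\<close> the mean of \<open>A\<^sup>\<otimes>\<^sup>p\<close>; applying \<open>B\<^sup>T\<close> shifts the series
  by one term.
\<close>

lemma contracted_functional_exists:
  fixes idx :: "'m::finite \<Rightarrow> nat \<Rightarrow> 'n"
  assumes idx: "multi_indexing p idx" and p: "p \<ge> 1" and \<gamma>: "p_radius p \<mu> < \<gamma>"
    and K: "\<And>M. M \<in> supp \<mu> \<Longrightarrow> (\<lambda>x. M *v x) ` K \<subseteq> K"
    and f: "f \<in> dual_cone (tensor_cone idx p K)"
  obtains F where
    "\<And>y. y \<in> tensor_cone idx p K \<Longrightarrow> f \<bullet> y \<le> F \<bullet> y"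
    "\<And>y. y \<in> tensor_cone idx p K \<Longrightarrow> F \<bullet> mean_kron idx p y \<le> \<gamma> ^ p * (F \<bullet> y)"
proof -
  \<comment> \<open>The moments are eventually below \<open>c ^ (p * k)\<close>, so the gap between
    \<open>c\<close> and \<open>\<gamma>\<close> leaves a geometric series of ratio
    \<open>(c / \<gamma>) ^ p\<close>.\<close>
  obtain c where c: "p_radius p \<mu> < c" "c < \<gamma>"
    using \<gamma> dense by blast
  have "c > 0" "\<gamma> > 0"
    using c p_radius_nonneg[OF p] by auto
  define G where "G k = (1 / \<gamma> ^ p) ^ k *\<^sub>R dual_moment idx p f k" for k
  define F where "F = suminf G"
  let ?q = "(c / \<gamma>) ^ p" and ?C = "real CARD('m) * norm f"
  have "?q < 1"
    using c \<open>c > 0\<close> p by (intro power_Suc_less_one[of _ "p - 1", simplified] power_less_one_iff[THEN iffD2]) auto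
  have "eventually (\<lambda>k. norm (G k) \<le> ?C * ?q ^ k) sequentially"
    using moment_eventually_le[OF p c(1)]
  proof eventually_elim
    case (elim k)
    have "norm (dual_moment idx p f k) \<le> ?C * c ^ (p * k)"
      using norm_dual_moment_le[OF idx, of f k] elim
      by (meson mult_left_mono mult_nonneg_nonneg norm_ge_zero of_nat_0_le_iff order_trans)
    then have "(1 / \<gamma> ^ p) ^ k * norm (dual_moment idx p f k) \<le> (1 / \<gamma> ^ p) ^ k * (?C * c ^ (p * k))"
      using \<open>\<gamma> > 0\<close> by (intro mult_left_mono) auto
    then show ?case
      using \<open>\<gamma> > 0\<close> by (simp add: G_def power_divide power_mult)
  qed
  moreover have "summable (\<lambda>k. ?C * ?q ^ k)"
    using \<open>?q < 1\<close> \<open>c > 0\<close> \<open>\<gamma> > 0\<close> by (intro summable_mult summable_geometric) simp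
  ultimately have "summable G"
    by (rule summable_comparison_test_ev)
  then have F_inner: "F \<bullet> y = (\<Sum>k. G k \<bullet> y)" and G_summable: "summable (\<lambda>k. G k \<bullet> y)" for y
    unfolding F_def using bounded_linear.suminf[OF bounded_linear_inner_left]
      bounded_linear.summable[OF bounded_linear_inner_left] by blast+
  have G0: "G 0 \<bullet> y = f \<bullet> y" for y
    using prob_space.prob_space[OF prob_space_switching_law]
    by (simp add: G_def inner_dual_moment kron_matrix_one[OF idx])
  have G_Suc: "G k \<bullet> mean_kron idx p y = \<gamma> ^ p * (G (Suc k) \<bullet> y)" for k y
    using \<open>\<gamma> > 0\<close> by (simp add: G_def dual_moment_mean_kron[OF idx])
  show thesis
  proof
    fix y assume y: "y \<in> tensor_cone idx p K"
    have nonneg: "0 \<le> G k \<bullet> y" for k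
      using dual_moment_nonneg[OF idx K f y, of k] \<open>\<gamma> > 0\<close> by (simp add: G_def)
    then show "f \<bullet> y \<le> F \<bullet> y"
      using sum_le_suminf[OF G_summable[of y], of "{0}"] by (simp add: F_inner G0)
    have "F \<bullet> mean_kron idx p y = \<gamma> ^ p * (\<Sum>k. G (Suc k) \<bullet> y)"
      using G_summable[of y] by (simp add: F_inner G_Suc suminf_mult summable_Suc_iff[of "\<lambda>k. G k \<bullet> y"])
    also have "\<dots> = \<gamma> ^ p * (F \<bullet> y - G 0 \<bullet> y)"
      using suminf_split_head[OF G_summable[of y]] by (simp add: F_inner)
    \<comment> \<open>The term lost by the shift is nonnegative on the cone.\<close>
    also have "\<dots> \<le> \<gamma> ^ p * (F \<bullet> y)"
      using nonneg[of 0] \<open>\<gamma> > 0\<close> by (intro mult_left_mono) auto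
    finally show "F \<bullet> mean_kron idx p y \<le> \<gamma> ^ p * (F \<bullet> y)" .
  qed
qed

text \<open>A decomposition \<open>y = v - w\<close> in the cone is carried by each Kronecker power
  to a decomposition of the image. Its expected cost is
  \<open>F \<bullet> mean_kron idx p (v + w)\<close>, which the contraction bounds; the infimum over
  decompositions gives the growth rate.\<close>

lemma stochastic_lyapunov_cone_norm:
  fixes idx :: "'m::finite \<Rightarrow> nat \<Rightarrow> 'n"
  assumes idx: "multi_indexing p idx" and \<gamma>: "0 < \<gamma>" "\<gamma> < 1"
    and inv: "\<And>M. M \<in> supp \<mu> \<Longrightarrow> (\<lambda>x. M *v x) ` K \<subseteq> K"
    and F: "strictly_positive_functional (tensor_cone idx p K) F b"
    and contracted: "\<And>y. y \<in> tensor_cone idx p K \<Longrightarrow> F \<bullet> mean_kron idx p y \<le> \<gamma> ^ p * (F \<bullet> y)"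
  shows "stochastic_lyapunov \<mu> p \<gamma> (\<lambda>x. cone_norm (tensor_cone idx p K) F (kron_power idx p x))"
proof -
  interpret strictly_positive_functional "tensor_cone idx p K" F b
    by (rule F)
  let ?N = "cone_norm (tensor_cone idx p K) F"
  obtain C where C: "C > 0" "\<And>x. ?N x \<le> C * norm x"
    using cone_norm_upper by blast
  have kron_mult: "kron_power idx p (A *v x) = kron_matrix idx p A *v kron_power idx p x" for A x
    by (simp add: kron_power_eq kron_matrix_elementary_tensor[OF idx])
  have norm_kron: "norm (kron_power idx p x) = norm x ^ p" for x
    by (simp add: kron_power_eq norm_elementary_tensor[OF idx])
  have integrable: "integrable \<mu> (\<lambda>A. ?N (kron_matrix idx p A *v y))" for y
    by (intro integrable_continuous continuous_on_compose2[OF continuous_cone_norm]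
        continuous_kron_matrix_mult) auto
  have mean: "(\<integral>A. ?N (kron_matrix idx p A *v y) \<partial>\<mu>) \<le> \<gamma> ^ p * ?N y" for y
  proof -
    \<comment> \<open>Dividing by the factor leaves a bare cone norm on the right, as
      \<open>cone_norm_geI\<close> requires.\<close>
    have "(\<integral>A. ?N (kron_matrix idx p A *v y) \<partial>\<mu>) / \<gamma> ^ p \<le> ?N y"
    proof (rule cone_norm_geI)
      fix v w assume vw: "v \<in> tensor_cone idx p K" "w \<in> tensor_cone idx p K" "y = v - w"
      have "(\<integral>A. ?N (kron_matrix idx p A *v y) \<partial>\<mu>) \<le> (\<integral>A. F \<bullet> (kron_matrix idx p A *v (v + w)) \<partial>\<mu>)"
      proof (rule integral_mono_AE)
        show "AE A in \<mu>. ?N (kron_matrix idx p A *v y) \<le> F \<bullet> (kron_matrix idx p A *v (v + w))"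
          using AE_in_supp[OF sets_eq]
        proof eventually_elim
          case (elim A)
          have "?N (kron_matrix idx p A *v v - kron_matrix idx p A *v w) \<le>
              F \<bullet> (kron_matrix idx p A *v v + kron_matrix idx p A *v w)"
            using vw inv[OF elim] by (intro cone_norm_le kron_matrix_tensor_cone[OF idx]) auto
          then show ?case
            by (simp add: vw(3) matrix_vector_mult_diff_distrib matrix_vector_right_distrib)
        qed
      qed (auto intro: integrable integrable_inner_right integrable_kron_matrix_mult)
      also have "\<dots> \<le> \<gamma> ^ p * (F \<bullet> (v + w))"
        using contracted[OF add_mem[OF vw(1,2)]] by (simp only: inner_mean_kron)
      finally show "(\<integral>A. ?N (kron_matrix idx p A *v y) \<partial>\<mu>) / \<gamma> ^ p \<le> F \<bullet> (v + w)"
        using \<gamma> by (simp add: divide_le_eq mult.commute)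
    qed
    then show ?thesis
      using \<gamma> by (simp add: divide_le_eq mult.commute)
  qed
  show ?thesis
    unfolding stochastic_lyapunov_def kron_mult
    using \<gamma> b C integrable mean cone_norm_lower
    by (intro conjI exI[of _ b] exI[of _ C] allI) (auto simp flip: norm_kron)
qed

end

section \<open>Existence of the Lyapunov norm\<close>

theorem theorem5p11:
  fixes p :: nat and \<mu> :: "(real^'n^'n) measure" and \<gamma> :: real
    and idx :: "'m::finite \<Rightarrow> nat \<Rightarrow> 'n"
  assumes "p \<ge> 1"
    and "prob_space \<mu>" and "sets \<mu> = sets borel"
    and "bounded (supp \<mu>)"
    and "\<exists>K :: (real^'n) set. proper_cone K \<and> (\<forall>M\<in>supp \<mu>. (\<lambda>x. M *v x) ` K \<subseteq> K)"
    and "mean_stable p \<mu>"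
    and "p_radius p \<mu> < \<gamma>" and "\<gamma> < 1"
    and "multi_indexing p idx"
  shows "\<exists>N :: real^'m \<Rightarrow> real.
           cone_linear_absolute_norm N \<and>
           stochastic_lyapunov \<mu> p \<gamma> (\<lambda>x. N (kron_power idx p x))"
proof -
  interpret bounded_matrix_law \<mu>
    using assms(2-4) by (simp add: bounded_matrix_law_def bounded_matrix_law_axioms_def)
  obtain K :: "(real^'n) set" where K: "proper_cone K"
    and inv: "\<And>M. M \<in> supp \<mu> \<Longrightarrow> (\<lambda>x. M *v x) ` K \<subseteq> K"
    using assms(5) by blast
  let ?T = "tensor_cone idx p K"
  have T: "proper_cone ?T"
    using assms(9) K by (rule proper_cone_tensor_cone)
  then obtain f b where b: "b > 0" and f: "\<And>y. y \<in> ?T \<Longrightarrow> b * norm y \<le> f \<bullet> y"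
    using pointed_cone_separation[of ?T] unfolding proper_cone_def by metis
  have "f \<in> dual_cone ?T"
    unfolding dual_cone_def using f b
    by (auto intro: order_trans[OF mult_nonneg_nonneg[OF less_imp_le norm_ge_zero]])
  then obtain F where F: "\<And>y. y \<in> ?T \<Longrightarrow> f \<bullet> y \<le> F \<bullet> y"
      and contracted: "\<And>y. y \<in> ?T \<Longrightarrow> F \<bullet> mean_kron idx p y \<le> \<gamma> ^ p * (F \<bullet> y)"
    using contracted_functional_exists[OF assms(9,1,7) inv] by metis
  \<comment> \<open>Since \<open>F\<close> dominates \<open>f\<close> on the cone, it inherits the
    constant \<open>b\<close>.\<close>
  interpret strictly_positive_functional ?T F b
    using T b f F by unfold_locales (auto intro: order_trans)
  have "0 < \<gamma>"
    using p_radius_nonneg[OF assms(1)] assms(7) by simp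
  then have "stochastic_lyapunov \<mu> p \<gamma> (\<lambda>x. cone_norm ?T F (kron_power idx p x))"
    using assms(8,9) inv contracted strictly_positive_functional_axioms
    by (intro stochastic_lyapunov_cone_norm) auto
  then show ?thesis
    using cone_linear_absolute_norm_cone_norm by blast
qed

end
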